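(* Let $n$ be even and $k$ odd with $2\le k\le n/2$. Then there exists a 1-parameter family of pairwise non-congruent, non-regular, convex plane bicycle $(n,k)$-gons.
   Context: Let $P$ be an $n$-gon in the plane with consecutive vertices $V_1,V_2,\dots,V_n$, indices understood cyclically modulo $n$. A $k$-diagonal is a segment $V_iV_{i+k}$. For integers $n,k$ with $2\le k\le n/2$, $P$ is called a bicycle $(n,k)$-gon if all its sides $V_iV_{i+1}$ have equal lengths and all its $k$-diagonals $V_iV_{i+k}$, $i=1,\dots,n$, have equal lengths. A 1-parameter family means a family depending continuously on a parameter in an open interval. *)

theory Defs
  imports "HOL-Analysis.Analysis"
begin

text \<open>
  The plane is \<^typ>\<open>complex\<close>. An n-gon is given by the values V 0, ..., V (n - 1) of
  a function V; all indices are reduced modulo n.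
\<close>

definition polygon_diagonal :: "nat \<Rightarrow> nat \<Rightarrow> (nat \<Rightarrow> complex) \<Rightarrow> nat \<Rightarrow> real" where
  "polygon_diagonal n k V i = dist (V (i mod n)) (V ((i + k) mod n))"

definition bicycle_polygon :: "nat \<Rightarrow> nat \<Rightarrow> (nat \<Rightarrow> complex) \<Rightarrow> bool" where
  "bicycle_polygon n k V \<longleftrightarrow>
     2 \<le> k \<and> 2 * k \<le> n \<and>
     (\<exists>s. \<forall>i<n. polygon_diagonal n 1 V i = s) \<and>
     (\<exists>d. \<forall>i<n. polygon_diagonal n k V i = d)"

definition polygon_curve :: "nat \<Rightarrow> (nat \<Rightarrow> complex) \<Rightarrow> complex set" where
  "polygon_curve n V = (\<Union>i<n. closed_segment (V i) (V (Suc i mod n)))"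

text \<open>
  The sides together form the boundary of a convex set, and the listed points are n
  distinct genuine corners of it. For n at least 3 this forces the hull to be
  two-dimensional and the sides to be its n edges, each listed once and in cyclic
  order; in particular the polygon is simple and has no straight angles.
\<close>

definition convex_polygon :: "nat \<Rightarrow> (nat \<Rightarrow> complex) \<Rightarrow> bool" where
  "convex_polygon n V \<longleftrightarrow>
     3 \<le> n \<and> inj_on V {..<n} \<and>
     (\<forall>i<n. V i extreme_point_of (convex hull (V ` {..<n}))) \<and>
     polygon_curve n V = frontier (convex hull (V ` {..<n}))"

definition angle_at :: "complex \<Rightarrow> complex \<Rightarrow> complex \<Rightarrow> real" where
  "angle_at x y z = arccos (((x - y) \<bullet> (z - y)) / (norm (x - y) * norm (z - y)))"

text \<open>
  The unsigned angle between adjacent sides is the interior angle because the polygon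
  is required to be convex. The predecessor of i modulo n is written as i + (n - 1).
\<close>

definition regular_polygon :: "nat \<Rightarrow> (nat \<Rightarrow> complex) \<Rightarrow> bool" where
  "regular_polygon n V \<longleftrightarrow>
     convex_polygon n V \<and>
     (\<exists>s. \<forall>i<n. polygon_diagonal n 1 V i = s) \<and>
     (\<exists>\<alpha>. \<forall>i<n. angle_at (V ((i + (n - 1)) mod n)) (V i) (V (Suc i mod n)) = \<alpha>)"

text \<open>
  Congruence of the polygons as plane figures: it does not depend on the labelling of
  the vertices, and orientation-reversing isometries are allowed.
\<close>

definition congruent_polygons :: "nat \<Rightarrow> (nat \<Rightarrow> complex) \<Rightarrow> (nat \<Rightarrow> complex) \<Rightarrow> bool" where
  "congruent_polygons n V W \<longleftrightarrow>
     (\<exists>f :: complex \<Rightarrow> complex. (\<forall>x y. dist (f x) (f y) = dist x y) \<and>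
        f ` polygon_curve n V = polygon_curve n W)"

end

theory Submission
  imports Defs
begin

text \<open>
  Write \<open>n = 2 * m\<close> and place the vertices at the angles of a regular n-gon, with distances from the
  origin alternating between 1 and t. Since k is odd, every side and every k-diagonal joins a
  vertex at distance 1 to one at distance t under a fixed angle, so the polygon is bicycle for every
  t. It is convex as long as t exceeds \<open>cos (pi / m)\<close>, the distance from the origin to the
  line through two neighbouring vertices at distance 1. For \<open>t < 1\<close> it has two different angles.
  An isometry between two such polygons maps extreme points of the hulls to each other,
  hence fixes their common centroid 0 and preserves the set of vertex distances
  \<open>{1, t}\<close>, which determines t.
\<close>

section \<open>Vertices, angles and distances\<close>

definition alt_radius :: "real \<Rightarrow> nat \<Rightarrow> real" where
  "alt_radius t j = (if even j then 1 else t)"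

text \<open>The angle step is \<open>2 * pi / n\<close> for \<open>n = 2 * m\<close>. Defining the
  points for every natural index lets the successor of a vertex be written \<open>Suc j\<close>
  without reduction.\<close>

definition alt_polygon :: "nat \<Rightarrow> real \<Rightarrow> nat \<Rightarrow> complex" where
  "alt_polygon m t j = of_real (alt_radius t j) * cis (real j * (pi / real m))"

lemma inner_i_times: "a \<bullet> (\<i> * b) = Im a * Re b - Re a * Im b"
  by (simp add: inner_complex_def)

lemma inner_cis:
  "(of_real r * cis x) \<bullet> (of_real s * cis y) = r * s * cos (x - y)"
  by (simp add: inner_complex_def cos_diff algebra_simps)

text \<open>With \<open>3 \<le> m\<close> the step \<theta> is at most \<open>pi / 3\<close>, so
  that its sine and cosine are both positive.\<close>

locale alternating_polygon =
  fixes m :: nat and t :: real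
  assumes m3: "3 \<le> m" and t_gt: "cos (pi / real m) < t" and t_less: "t < 1"
begin

abbreviation "\<theta> \<equiv> pi / real m"
abbreviation "r \<equiv> alt_radius t"
abbreviation "V \<equiv> alt_polygon m t"
abbreviation "H \<equiv> convex hull (V ` {..<2 * m})"

lemma theta: "0 < \<theta>" "\<theta> \<le> pi / 3" "real m * \<theta> = pi"
  using m3 by (auto simp: field_simps)

lemma sin_theta: "0 < sin \<theta>" and cos_theta: "0 < cos \<theta>"
proof -
  show "0 < sin \<theta>" using theta(1,2) pi_gt_zero by (intro sin_gt_zero) linarith+
  show "0 < cos \<theta>" using theta(1,2) pi_gt_zero by (intro cos_gt_zero) linarith+
qed

lemma t_pos: "0 < t"
  using cos_theta t_gt by linarith

lemma r_pos: "0 < r j"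
  using t_pos by (simp add: alt_radius_def)

lemma r_mult_Suc: "r i * r (Suc i) = t"
  by (simp add: alt_radius_def)

text \<open>Reduction changes the angle by a multiple of \<open>2 * pi\<close>, and it keeps the
  radius because the modulus is even.\<close>

lemma V_mod: "V (j mod (2 * m)) = V j"
proof -
  define q where "q = j div (2 * m)"
  have j: "j = j mod (2 * m) + 2 * m * q"
    by (simp add: q_def)
  have "real j * \<theta> = real (j mod (2 * m)) * \<theta> + 2 * pi * real q"
  proof -
    have "real j = real (j mod (2 * m)) + 2 * real m * real q"
      using j by (metis of_nat_add of_nat_mult of_nat_numeral)
    then show ?thesis using m3 by (simp add: field_simps)
  qed
  moreover have "even (j mod (2 * m)) = even j"
    by (simp add: dvd_mod_iff)
  ultimately show ?thesis
    by (simp add: alt_polygon_def alt_radius_def cis_mult[symmetric] cis_multiple_2pi)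
qed

text \<open>The law of cosines in the triangle with apex 0.\<close>

lemma dist_V_sq: "(dist (V i) (V j))\<^sup>2 = (r i)\<^sup>2 + (r j)\<^sup>2 - 2 * r i * r j * cos (real i * \<theta> - real j * \<theta>)"
proof -
  have "(dist (V i) (V j))\<^sup>2 = (V i - V j) \<bullet> (V i - V j)"
    by (simp add: dist_norm power2_norm_eq_inner)
  also have "\<dots> = V i \<bullet> V i + V j \<bullet> V j - 2 * (V i \<bullet> V j)"
    by (simp add: inner_diff_left inner_diff_right inner_commute)
  finally show ?thesis
    by (simp add: alt_polygon_def inner_cis power2_eq_square)
qed

lemma dist_odd_step:
  assumes "odd k"
  shows "dist (V i) (V (i + k)) = sqrt (1 + t\<^sup>2 - 2 * t * cos (real k * \<theta>))"
proof -
  have "cos (real i * \<theta> - real (i + k) * \<theta>) = cos (real k * \<theta>)"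
    by (metis (no_types, opaque_lifting) add_diff_cancel_left' cos_minus distrib_right minus_diff_eq of_nat_add)
  moreover have "(r i)\<^sup>2 + (r (i + k))\<^sup>2 = 1 + t\<^sup>2" "r i * r (i + k) = t"
    using assms by (auto simp: alt_radius_def)
  ultimately have "(dist (V i) (V (i + k)))\<^sup>2 = 1 + t\<^sup>2 - 2 * t * cos (real k * \<theta>)"
    unfolding dist_V_sq by (simp add: mult.assoc)
  then show ?thesis
    by (metis real_sqrt_unique zero_le_dist)
qed

lemma diagonal_odd:
  assumes "odd k"
  shows "polygon_diagonal (2 * m) k V i = sqrt (1 + t\<^sup>2 - 2 * t * cos (real k * \<theta>))"
  unfolding polygon_diagonal_def V_mod by (rule dist_odd_step[OF assms])

section \<open>The vertices are distinct corners\<close>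

text \<open>In its own direction \<open>V i\<close> is the unique highest vertex: every other vertex
  is turned away by at least \<theta>, so its height is at most \<open>r j * cos \<theta>\<close>.
  Both injectivity and extremality follow from this.\<close>

lemma inner_cis_less:
  assumes "i < 2 * m" "j < 2 * m" "j \<noteq> i"
  shows "V j \<bullet> cis (real i * \<theta>) < r i"
proof -
  define e where "e = \<bar>real j - real i\<bar> * \<theta>"
  have e: "cos (real j * \<theta> - real i * \<theta>) = cos e"
  proof (cases "j \<le> i")
    case True
    then have "real j * \<theta> - real i * \<theta> = - e"
      by (simp add: e_def left_diff_distrib diff_divide_distrib)
    then show ?thesis by (simp only: cos_minus)
  next
    case False
    then have "real j * \<theta> - real i * \<theta> = e"
      by (simp add: e_def left_diff_distrib diff_divide_distrib)
    then show ?thesis by (simp only:)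
  qed
  have d1: "1 \<le> \<bar>real j - real i\<bar>" "\<bar>real j - real i\<bar> \<le> 2 * real m - 1"
    using assms by linarith+
  have e1: "\<theta> \<le> e" 
    using mult_right_mono[OF d1(1), of \<theta>] theta(1) by (simp add: e_def)
  have e2: "e \<le> 2 * pi - \<theta>"
    using mult_right_mono[OF d1(2), of \<theta>] theta(1)
    unfolding e_def left_diff_distrib mult.assoc theta(3) by simp
  have ce: "cos e \<le> cos \<theta>"
  proof (cases "e \<le> pi")
    case True
    then show ?thesis using e1 theta(1) by (intro cos_monotone_0_pi_le) auto
  next
    case False
    \<comment> \<open>Reflecting the angle brings it back into the range where cosine
      decreases.\<close>
    have "cos (2 * pi - e) \<le> cos \<theta>"
      using e2 False theta(1) by (intro cos_monotone_0_pi_le) auto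
    then show ?thesis by (simp add: cos_diff)
  qed
  have "V j \<bullet> cis (real i * \<theta>) = r j * cos e"
    using inner_cis[of "r j" "real j * \<theta>" 1 "real i * \<theta>"] e by (simp add: alt_polygon_def)
  also have "\<dots> \<le> r j * cos \<theta>"
    using ce r_pos[of j] by simp
  also have "\<dots> < r i"
  proof -
    \<comment> \<open>Together with \<open>t_gt\<close> these cover the four combinations of radii;
      \<open>t_gt\<close> itself is the case of \<open>r j = 1\<close> and
      \<open>r i = t\<close>.\<close>
    have "cos \<theta> < 1" "t * cos \<theta> < 1" "t * cos \<theta> < t"
      using t_gt t_less t_pos mult_strict_right_mono[OF t_less cos_theta]
        mult_strict_left_mono[of "cos \<theta>" 1 t] by linarith+
    then show ?thesis using t_gt by (simp add: alt_radius_def)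
  qed
  finally show ?thesis .
qed

lemma inner_cis_self: "V i \<bullet> cis (real i * \<theta>) = r i"
  using inner_cis[of "r i" "real i * \<theta>" 1 "real i * \<theta>"] by (simp add: alt_polygon_def)

lemma inj_V: "inj_on V {..<2 * m}"
  by (rule inj_onI) (metis inner_cis_less inner_cis_self lessThan_iff less_irrefl)

text \<open>An open half-plane contains the hull of the other vertices but not \<open>V i\<close>,
  and a point added outside a convex hull is extreme in the enlarged hull.\<close>

lemma V_extreme:
  assumes "i < 2 * m"
  shows "V i extreme_point_of H"
proof -
  let ?S = "V ` ({..<2 * m} - {i})"
  have "?S \<subseteq> {z. cis (real i * \<theta>) \<bullet> z < r i}"
    using inner_cis_less[OF assms] by (auto simp: inner_commute)
  then have "convex hull ?S \<subseteq> {z. cis (real i * \<theta>) \<bullet> z < r i}"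
    by (intro hull_minimal convex_halfspace_lt)
  then have "V i \<notin> convex hull ?S"
    using inner_cis_self[of i] by (auto simp: inner_commute)
  moreover have "insert (V i) ?S = V ` {..<2 * m}"
    using assms by auto
  ultimately show ?thesis
    using extreme_point_of_convex_hull_insert[of ?S "V i"] by simp
qed

section \<open>The trigonometric inequality behind convexity\<close>

text \<open>Each bound on \<rho> settles one sign of \<open>cos e\<close>. The upper one combines
  with \<open>cos e \<le> cos \<theta> * cos (e - \<theta>)\<close> when \<open>cos e\<close> is
  positive; the lower one reduces the other case to
  \<open>sin e * sin \<theta> \<ge> 0\<close>.\<close>

lemma sin_cos_bound_aux:
  assumes \<rho>: "cos \<theta> < \<rho>" "\<rho> * cos \<theta> < 1" and e: "\<theta> \<le> e" "e \<le> pi"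
  shows "0 \<le> cos (e - \<theta>) - \<rho> * cos e"
proof (cases "0 < cos e")
  case True
  have "cos e = cos \<theta> * cos (e - \<theta>) - sin \<theta> * sin (e - \<theta>)"
    using cos_add[of \<theta> "e - \<theta>"] by simp
  moreover have "0 \<le> sin \<theta> * sin (e - \<theta>)"
    using e sin_theta theta(1) by (intro mult_nonneg_nonneg sin_ge_zero) auto
  ultimately have "cos e \<le> cos \<theta> * cos (e - \<theta>)" by linarith
  moreover have "(\<rho> * cos \<theta>) * cos e \<le> 1 * cos e"
    using \<rho> True by (intro mult_right_mono) auto
  ultimately have "cos \<theta> * (\<rho> * cos e) \<le> cos \<theta> * cos (e - \<theta>)"
    by (simp add: mult_ac)
  then show ?thesis using cos_theta by simp
next
  case False
  have "\<rho> * cos e \<le> cos \<theta> * cos e"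
    using False \<rho> by (intro mult_right_mono_neg) auto
  moreover have "0 \<le> sin e * sin \<theta>"
    using e sin_theta theta(1) by (intro mult_nonneg_nonneg sin_ge_zero) auto
  ultimately show ?thesis by (simp add: cos_diff mult.commute)
qed

text \<open>The left-hand side has period \<open>pi\<close> in the angle, so it suffices to treat \<open>0 \<le> p < m\<close>.\<close>

lemma sin_cos_bound:
  fixes p :: int
  assumes \<rho>: "cos \<theta> < \<rho>" "\<rho> * cos \<theta> < 1"
  shows "0 \<le> sin (of_int p * \<theta>) * (cos (of_int p * \<theta> - \<theta>) - \<rho> * cos (of_int p * \<theta>))"
proof -
  define q where "q = p mod int m"
  define l where "l = p div int m"
  have q: "0 \<le> q" "q < int m" using m3 by (auto simp: q_def)
  have "p = q + int m * l" by (simp add: q_def l_def)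
  then have "of_int p * \<theta> = of_int q * \<theta> + of_int l * (real m * \<theta>)"
    by (simp add: algebra_simps add_divide_distrib)
  then have p: "of_int p * \<theta> = of_int q * \<theta> + of_int l * pi"
    by (simp only: theta(3))
  \<comment> \<open>\<open>c\<close> is the sign gained by shifting the angle by \<open>l\<close>
    half-turns. It enters both factors of the product and so cancels.\<close>
  define c where "c = cos (of_int l * pi)"
  have s0: "sin (of_int l * pi) = 0"
    by (simp add: sin_times_pi_eq_0)
  have c2: "c * c = 1"
    using sin_cos_squared_add[of "of_int l * pi"] s0 by (simp add: c_def power2_eq_square)
  have "sin (of_int p * \<theta>) = c * sin (of_int q * \<theta>)"
    "cos (of_int p * \<theta>) = c * cos (of_int q * \<theta>)"
    "cos (of_int p * \<theta> - \<theta>) = c * cos (of_int q * \<theta> - \<theta>)"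
    unfolding p cos_diff cos_add sin_add s0 c_def by (auto simp: algebra_simps)
  then have "sin (of_int p * \<theta>) * (cos (of_int p * \<theta> - \<theta>) - \<rho> * cos (of_int p * \<theta>))
    = (c * c) * (sin (of_int q * \<theta>) * (cos (of_int q * \<theta> - \<theta>) - \<rho> * cos (of_int q * \<theta>)))"
    by (simp add: algebra_simps)
  moreover have "0 \<le> sin (of_int q * \<theta>) * (cos (of_int q * \<theta> - \<theta>) - \<rho> * cos (of_int q * \<theta>))"
  proof (cases "q = 0")
    case False
    then have "1 \<le> real_of_int q" "real_of_int q \<le> real m"
      using q by linarith+
    then have "1 * \<theta> \<le> of_int q * \<theta>" "of_int q * \<theta> \<le> real m * \<theta>"
      using theta(1) by (intro mult_right_mono; simp)+
    then have q\<theta>: "\<theta> \<le> of_int q * \<theta>" "of_int q * \<theta> \<le> pi"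
      unfolding theta(3) by auto
    then have "0 \<le> of_int q * \<theta>" using theta(1) by linarith
    then show ?thesis
      using q\<theta> by (intro mult_nonneg_nonneg[OF sin_ge_zero sin_cos_bound_aux] \<rho>)
  qed simp
  ultimately show ?thesis by (simp add: c2)
qed

text \<open>For even \<open>d\<close> the half angle \<open>e\<close> is again a multiple of
  \<theta>, and double-angle formulas turn the gap between the two sides into twice the product in
  \<open>sin_cos_bound\<close>.\<close>

lemma sin_bound_even:
  fixes d :: int
  assumes \<rho>: "cos \<theta> < \<rho>" "\<rho> * cos \<theta> < 1" and "even d"
  shows "sin (\<theta> - of_int d * \<theta>) + \<rho> * sin (of_int d * \<theta>) \<le> sin \<theta>"
proof -
  obtain p where p: "d = 2 * p" using \<open>even d\<close> by blast
  define e where "e = of_int p * \<theta>"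
  have d: "of_int d * \<theta> = 2 * e" by (simp add: p e_def)
  have "sin \<theta> - (sin (\<theta> - 2 * e) + \<rho> * sin (2 * e)) = 2 * (sin e * (cos (e - \<theta>) - \<rho> * cos e))"
  proof -
    have "sin \<theta> - (sin \<theta> * (1 - 2 * (sin e)\<^sup>2) - cos \<theta> * (2 * sin e * cos e) + \<rho> * (2 * sin e * cos e))
       = 2 * (sin e * (cos e * cos \<theta> + sin e * sin \<theta> - \<rho> * cos e))"
      by (simp add: algebra_simps power2_eq_square)
    then show ?thesis
      by (simp add: sin_diff cos_diff sin_double cos_double_sin)
  qed
  then show ?thesis
    using sin_cos_bound[OF \<rho>, of p] unfolding d e_def[symmetric] by linarith
qed

section \<open>Supporting lines through the edges\<close>

text \<open>The outward normal of an edge, obtained by a quarter turn. It is left unnormalised, so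
  that its value on the edge is \<open>t * sin \<theta>\<close> for every \<open>i\<close>.\<close>

definition normal :: "nat \<Rightarrow> complex" where
  "normal i = \<i> * (V i - V (Suc i))"

lemma inner_normal_V:
  "V j \<bullet> normal i = r j * (r (Suc i) * sin (real (Suc i) * \<theta> - real j * \<theta>)
      - r i * sin (real i * \<theta> - real j * \<theta>))"
  by (simp add: normal_def inner_i_times alt_polygon_def sin_diff algebra_simps)

lemma inner_normal_start: "V i \<bullet> normal i = t * sin \<theta>"
  unfolding inner_normal_V using r_mult_Suc[of i] 
  by (simp add: algebra_simps add_divide_distrib)

lemma inner_normal_end: "V (Suc i) \<bullet> normal i = t * sin \<theta>"
proof -
  have "real i * \<theta> - real (Suc i) * \<theta> = - \<theta>"
    by (simp add: algebra_simps add_divide_distrib)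
  then show ?thesis
    unfolding inner_normal_V using r_mult_Suc[of i] by (simp add: mult_ac)
qed

text \<open>Once a factor \<open>t\<close> is taken out, the parities of \<open>i\<close> and
  \<open>j\<close> leave a sum of \<open>a\<close> and \<open>b\<close> in which one has coefficient
  1 and the other \<open>t\<close> or \<open>1 / t\<close>. Even \<open>d\<close> is
  \<open>sin_bound_even\<close>; for odd \<open>d\<close> it is applied to \<open>1 - d\<close>,
  which swaps \<open>a\<close> and \<open>b\<close>.\<close>

lemma inner_normal_le: "V j \<bullet> normal i \<le> t * sin \<theta>"
proof -
  define d where "d = int j - int i"
  have ang: "real i * \<theta> - real j * \<theta> = - (of_int d * \<theta>)"
      "real (Suc i) * \<theta> - real j * \<theta> = \<theta> - of_int d * \<theta>"
      "of_int (1 - d) * \<theta> = \<theta> - of_int d * \<theta>"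
    by (simp_all add: d_def algebra_simps add_divide_distrib diff_divide_distrib)
  define a where "a = sin (of_int d * \<theta>)"
  define b where "b = sin (\<theta> - of_int d * \<theta>)"
  have inn: "V j \<bullet> normal i = r j * (r (Suc i) * b + r i * a)"
    unfolding inner_normal_V ang a_def b_def by simp
  have c1: "cos \<theta> < 1" using t_gt t_less by linarith
  \<comment> \<open>Both \<open>t\<close> and \<open>1 / t\<close> lie strictly between
    \<open>cos \<theta>\<close> and its reciprocal, as the bounds on \<rho> demand.\<close>
  have rt: "cos \<theta> < t" "t * cos \<theta> < 1"
    using t_gt c1 mult_strict_right_mono[OF t_less cos_theta] by linarith+
  have ri: "cos \<theta> < 1 / t" "1 / t * cos \<theta> < 1"
    using rt t_pos c1 by (auto simp: field_simps)
  have E: "b + \<rho> * a \<le> sin \<theta>" if "even d" "\<rho> = t \<or> \<rho> = 1 / t" for \<rho>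
    using that sin_bound_even[OF rt that(1)] sin_bound_even[OF ri that(1)]
    unfolding a_def b_def by auto
  have O: "a + \<rho> * b \<le> sin \<theta>" if "odd d" "\<rho> = t \<or> \<rho> = 1 / t" for \<rho>
  proof -
    have ev: "even (1 - d)" using that by simp
    show ?thesis
      using that sin_bound_even[OF rt ev] sin_bound_even[OF ri ev]
      unfolding ang a_def b_def by auto
  qed
  have par: "even d \<longleftrightarrow> (even j = even i)" by (auto simp: d_def)
  have T: "t * x \<le> t * sin \<theta>" if "x \<le> sin \<theta>" for x
    using that t_pos by simp
  consider "even i" "even j" | "even i" "odd j" | "odd i" "even j" | "odd i" "odd j" by blast
  then show ?thesis
  proof cases
    case 1
    then show ?thesis using T[OF E[of "1 / t"]] par t_pos
      by (simp add: inn alt_radius_def algebra_simps)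
  next
    case 2
    then show ?thesis using T[OF O[of t]] par
      by (simp add: inn alt_radius_def algebra_simps)
  next
    case 3
    then show ?thesis using T[OF O[of "1 / t"]] par t_pos
      by (simp add: inn alt_radius_def algebra_simps)
  next
    case 4
    then show ?thesis using T[OF E[of t]] par
      by (simp add: inn alt_radius_def algebra_simps)
  qed
qed

lemma hull_le:
  assumes "z \<in> H"
  shows "z \<bullet> normal i \<le> t * sin \<theta>"
proof -
  have "H \<subseteq> {z. normal i \<bullet> z \<le> t * sin \<theta>}"
    using inner_normal_le by (intro hull_minimal convex_halfspace_le) (auto simp: inner_commute)
  then show ?thesis using assms by (auto simp: inner_commute)
qed

lemma V_in_H: "V i \<in> H"
proof -
  have "V (i mod (2 * m)) \<in> H" using m3 by (intro hull_inc) auto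
  then show ?thesis by (simp add: V_mod)
qed

section \<open>Sectors from the centre, and the frontier of the hull\<close>

text \<open>The cones spanned by consecutive vertices cover the plane. The cone is found by rounding
  the argument of \<open>z\<close> down to a multiple of \<theta>, and \<open>x\<close> is the
  remaining angle.\<close>

lemma sector:
  obtains i a b where "i < 2 * m" "0 \<le> a" "0 \<le> b" "z = a *\<^sub>R V i + b *\<^sub>R V (Suc i)"
proof -
  define \<phi> where "\<phi> = Arg2pi z"
  define i where "i = nat \<lfloor>\<phi> / \<theta>\<rfloor>"
  have \<phi>: "0 \<le> \<phi>" "\<phi> < 2 * pi"
    by (auto simp: \<phi>_def Arg2pi_ge_0 Arg2pi_lt_2pi)
  have z: "z = of_real (norm z) * cis \<phi>"
    using Arg2pi_eq[of z] by (simp add: \<phi>_def cis_conv_exp)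
  have "0 \<le> \<phi> / \<theta>" using \<phi> theta by auto
  then have ri: "real i = of_int \<lfloor>\<phi> / \<theta>\<rfloor>" by (simp add: i_def)
  have "real i \<le> \<phi> / \<theta>" "\<phi> / \<theta> < real i + 1"
    unfolding ri by linarith+
  then have i: "real i * \<theta> \<le> \<phi>" "\<phi> < (real i + 1) * \<theta>"
    using theta(1) by (simp_all add: pos_le_divide_eq pos_divide_less_eq del: divide_divide_eq_right times_divide_eq_right)
  have "real i * \<theta> < 2 * (real m * \<theta>)" using i \<phi> theta(3) by linarith
  then have "real i * \<theta> < (2 * real m) * \<theta>" by (simp only: mult.assoc)
  then have "real i < 2 * real m" using theta(1) by (metis mult_less_cancel_right_pos)
  then have "i < 2 * m" by linarith
  define x where "x = \<phi> - real i * \<theta>"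
  have x: "0 \<le> x" "x \<le> \<theta>" using i unfolding x_def distrib_right by linarith+
  have nn: "0 \<le> sin x" "0 \<le> sin (\<theta> - x)"
    using x theta(1,2) pi_gt_zero by (intro sin_ge_zero; linarith)+
  \<comment> \<open>By the sine rule \<open>sin (\<theta> - x)\<close> and \<open>sin x\<close>,
    over \<open>sin \<theta>\<close>, are the coordinates of a unit vector along the two unit rays;
    dividing by the radii passes to the vertices.\<close>
  define a where "a = norm z * sin (\<theta> - x) / (sin \<theta> * r i)"
  define b where "b = norm z * sin x / (sin \<theta> * r (Suc i))"
  have a0: "0 \<le> a" and b0: "0 \<le> b"
    using nn sin_theta r_pos[of i] r_pos[of "Suc i"] by (auto simp: a_def b_def)
  have ph: "\<phi> = real i * \<theta> + x" by (simp add: x_def)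
  have trig: "sin \<theta> * cis \<phi> = sin (\<theta> - x) * cis (real i * \<theta>) + sin x * cis (real (Suc i) * \<theta>)"
  proof -
    have s: "real (Suc i) * \<theta> = real i * \<theta> + \<theta>" by (simp add: algebra_simps add_divide_distrib)
    have "sin \<theta> * cis x = of_real (sin (\<theta> - x)) + sin x * cis \<theta>"
      by (simp add: complex_eq_iff sin_diff algebra_simps)
    then have "cis (real i * \<theta>) * (sin \<theta> * cis x) = cis (real i * \<theta>) * (of_real (sin (\<theta> - x)) + sin x * cis \<theta>)"
      by simp
    then show ?thesis
      unfolding ph s cis_mult[symmetric] by (simp add: algebra_simps)
  qed
  have "a *\<^sub>R V i = of_real (norm z / sin \<theta>) * (of_real (sin (\<theta> - x)) * cis (real i * \<theta>))"
    "b *\<^sub>R V (Suc i) = of_real (norm z / sin \<theta>) * (of_real (sin x) * cis (real (Suc i) * \<theta>))"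
    using r_pos[of i] r_pos[of "Suc i"] sin_theta
    unfolding alt_polygon_def scaleR_conv_of_real a_def b_def
    by (simp_all add: field_simps)
  then have "a *\<^sub>R V i + b *\<^sub>R V (Suc i) = of_real (norm z / sin \<theta>) * (sin \<theta> * cis \<phi>)"
    unfolding trig by (simp add: distrib_left)
  also have "\<dots> = z"
    using sin_theta z by simp
  finally show ?thesis using that[OF \<open>i < 2 * m\<close> a0 b0] by simp
qed

lemma zero_less_ts: "0 < t * sin \<theta>"
  using t_pos sin_theta by simp

lemma segment_subset_H: "closed_segment (V i) (V (Suc i)) \<subseteq> H"
  by (intro closed_segment_subset V_in_H convex_convex_hull)


text \<open>\<open>V m\<close> lies opposite to \<open>V 0\<close>, and the weight
  \<open>1 / (1 + r m)\<close> balances their distances 1 and \<open>r m\<close> from 0.\<close>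

lemma zero_in_H: "0 \<in> H"
proof -
  have "closed_segment (V 0) (V m) \<subseteq> H"
    by (intro closed_segment_subset V_in_H convex_convex_hull)
  moreover have "0 \<in> closed_segment (V 0) (V m)"
  proof -
    have "V 0 = 1" "V m = - of_real (r m)"
      using m3 by (simp_all add: alt_polygon_def alt_radius_def)
    then have "0 = (1 - 1 / (1 + r m)) *\<^sub>R V 0 + (1 / (1 + r m)) *\<^sub>R V m"
      using r_pos[of m] by (simp add: complex_eq_iff field_simps)
    then show ?thesis
      using r_pos[of m] unfolding in_segment
      by (intro exI[of _ "1 / (1 + r m)"]) (simp add: field_simps)
  qed
  ultimately show ?thesis by blast
qed

lemma sector_in_H:
  assumes "0 \<le> a" "0 \<le> b" "a + b \<le> 1"
  shows "a *\<^sub>R V i + b *\<^sub>R V (Suc i) \<in> H"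
proof -
  have "convex hull {0, V i, V (Suc i)} \<subseteq> H"
    using zero_in_H V_in_H by (intro hull_minimal convex_convex_hull) auto
  moreover have "a *\<^sub>R V i + b *\<^sub>R V (Suc i) \<in> convex hull {0, V i, V (Suc i)}"
    unfolding convex_hull_3 using assms
    by (intro CollectI exI[of _ "1 - a - b"] exI[of _ a] exI[of _ b]) auto
  ultimately show ?thesis by blast
qed

lemma inner_normal_sector:
  "(a *\<^sub>R V i + b *\<^sub>R V (Suc i)) \<bullet> normal i = (a + b) * (t * sin \<theta>)"
  by (simp add: inner_add_left inner_normal_start inner_normal_end distrib_right)

text \<open>The open half-planes bounded by the edge lines meet in an open set around 0. In sector
  coordinates each of its points has \<open>a + b < 1\<close>, hence lies in a triangle inside
  \<open>H\<close>.\<close>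

lemma zero_interior: "0 \<in> interior H"
proof -
  let ?U = "\<Inter>i<2 * m. {z. normal i \<bullet> z < t * sin \<theta>}"
  have "?U \<subseteq> H"
  proof
    fix z assume z: "z \<in> ?U"
    obtain i a b where i: "i < 2 * m" "0 \<le> a" "0 \<le> b" "z = a *\<^sub>R V i + b *\<^sub>R V (Suc i)"
      by (rule sector)
    have "z \<bullet> normal i < t * sin \<theta>" using z i(1) by (auto simp: inner_commute)
    then have "(a + b) * (t * sin \<theta>) < 1 * (t * sin \<theta>)"
      unfolding i(4) inner_normal_sector by simp
    then have "a + b < 1" using zero_less_ts by (metis mult_less_cancel_right_pos)
    then show "z \<in> H" unfolding i(4) by (intro sector_in_H i) auto
  qed
  then have "?U \<subseteq> interior H"
    by (intro interior_maximal open_INT ballI open_halfspace_lt) auto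
  then show ?thesis using zero_less_ts by auto
qed

lemma curve_eq: "polygon_curve (2 * m) V = (\<Union>i<2 * m. closed_segment (V i) (V (Suc i)))"
  by (simp add: polygon_curve_def V_mod)

text \<open>An edge lies on a supporting line, so it misses the interior. Conversely, the supporting
  line of the sector of a frontier point gives \<open>a + b \<le> 1\<close>, and strict inequality
  would make the point interior.\<close>

lemma curve_eq_frontier: "polygon_curve (2 * m) V = frontier H"
proof
  have cl: "closure H = H"
    by (intro closure_closed compact_imp_closed finite_imp_compact_convex_hull) auto
  show "polygon_curve (2 * m) V \<subseteq> frontier H"
  proof
    fix z assume "z \<in> polygon_curve (2 * m) V"
    then obtain i where zi: "z \<in> closed_segment (V i) (V (Suc i))"
      unfolding curve_eq by blast
    then obtain u where "z = (1 - u) *\<^sub>R V i + u *\<^sub>R V (Suc i)"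
      unfolding in_segment by blast
    then have zn: "z \<bullet> normal i = t * sin \<theta>"
      using inner_normal_sector[of "1 - u" i u] by simp
    have "normal i \<noteq> 0"
      using inner_normal_start[of i] zero_less_ts by auto
    have "H \<subseteq> {z. normal i \<bullet> z \<le> t * sin \<theta>}"
      using hull_le by (auto simp: inner_commute)
    then have "interior H \<subseteq> {z. normal i \<bullet> z < t * sin \<theta>}"
      using interior_mono interior_halfspace_le[OF \<open>normal i \<noteq> 0\<close>] by metis
    then have "z \<notin> interior H" using zn by (auto simp: inner_commute)
    then show "z \<in> frontier H"
      using zi segment_subset_H by (auto simp: frontier_def cl)
  qed
  show "frontier H \<subseteq> polygon_curve (2 * m) V"
  proof
    fix z assume "z \<in> frontier H"
    then have zH: "z \<in> H" "z \<notin> interior H" by (auto simp: frontier_def cl)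
    obtain i a b where i: "i < 2 * m" "0 \<le> a" "0 \<le> b" "z = a *\<^sub>R V i + b *\<^sub>R V (Suc i)"
      by (rule sector)
    have "(a + b) * (t * sin \<theta>) \<le> 1 * (t * sin \<theta>)"
      using hull_le[OF zH(1), of i] unfolding i(4) inner_normal_sector by simp
    then have "a + b \<le> 1" using zero_less_ts by (metis mult_le_cancel_right_pos)
    moreover have "\<not> a + b < 1"
    proof
      assume lt: "a + b < 1"
      show False
      proof (cases "a + b = 0")
        case True
        then have "a = 0" "b = 0" using i by linarith+
        then show False using zH(2) zero_interior i(4) by simp
      next
        case False
        \<comment> \<open>\<open>w\<close> is where the ray from 0 through \<open>z\<close> meets
          the edge; shrinking \<open>w\<close> towards the interior point 0 gives
          \<open>z\<close>.\<close>
        define w where "w = (a / (a + b)) *\<^sub>R V i + (b / (a + b)) *\<^sub>R V (Suc i)"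
        have "w \<in> H"
          unfolding w_def using False i
          by (intro sector_in_H) (auto simp: add_divide_distrib[symmetric])
        then have "w - (1 - (a + b)) *\<^sub>R (w - 0) \<in> interior H"
          using lt i by (intro mem_interior_convex_shrink zero_interior convex_convex_hull) auto
        moreover have "w - (1 - (a + b)) *\<^sub>R (w - 0) = (a + b) *\<^sub>R w"
          by (simp add: algebra_simps)
        moreover have "(a + b) *\<^sub>R w = z"
          unfolding w_def i(4) using False by (simp add: scaleR_add_right)
        ultimately show False using zH(2) by simp
      qed
    qed
    ultimately have "a = 1 - b" by linarith
    then have "z \<in> closed_segment (V i) (V (Suc i))"
      unfolding in_segment i(4) using i by auto
    then show "z \<in> polygon_curve (2 * m) V"
      unfolding curve_eq using i(1) by blast
  qed
qed

lemma convex: "convex_polygon (2 * m) V"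
  unfolding convex_polygon_def using m3 inj_V V_extreme curve_eq_frontier by auto

section \<open>Two different angles\<close>

text \<open>All sides being equal, equal angles at \<open>V 0\<close> and \<open>V 1\<close> would
  mean equal inner products of the adjacent sides. Their difference factors as
  \<open>(1 - t\<^sup>2) * (1 - cos (2 * \<theta>))\<close>, which is nonzero.\<close>

lemma not_regular: "\<not> regular_polygon (2 * m) V"
proof
  assume "regular_polygon (2 * m) V"
  then obtain \<alpha> where \<alpha>:
    "\<And>i. i < 2 * m \<Longrightarrow> angle_at (V ((i + (2 * m - 1)) mod (2 * m))) (V i) (V (Suc i mod (2 * m))) = \<alpha>"
    unfolding regular_polygon_def by blast
  \<comment> \<open>The cyclic predecessor of 0; it is odd, so \<open>V p\<close> has radius
    \<open>t\<close>.\<close>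
  define p where "p = 2 * m - 1"
  have p: "Suc p = 2 * m" "odd p" using m3 by (auto simp: p_def)
  define D where "D = dist (V 0) (V 1)"
  have D: "dist (V i) (V (Suc i)) = D" for i
    using dist_odd_step[of 1 i] dist_odd_step[of 1 0] by (simp add: D_def)
  have V2m: "V (2 * m) = V 0" using V_mod[of "2 * m"] by simp
  have "V 0 \<noteq> V 1"
    using inj_onD[OF inj_V, of 0 1] m3 by auto
  then have "0 < D" by (simp add: D_def)
  have nrm: "norm (V p - V 0) = D" "norm (V 1 - V 0) = D" "norm (V 0 - V 1) = D" "norm (V 2 - V 1) = D"
    using D[of p] D[of 0] D[of 1] V2m p(1)
    by (simp_all add: dist_norm norm_minus_commute numeral_2_eq_2)
  have a0: "angle_at (V p) (V 0) (V 1) = \<alpha>"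
    using \<alpha>[of 0] m3 by (simp add: V_mod p_def)
  have a1: "angle_at (V 0) (V 1) (V 2) = \<alpha>"
    using \<alpha>[of 1] m3 by (simp add: V_mod V2m numeral_2_eq_2)
  \<comment> \<open>Keeps the quotients in the interval on which \<open>arccos\<close> is
    injective.\<close>
  have le: "\<bar>(x \<bullet> y) / (D * D)\<bar> \<le> 1" if "norm x = D" "norm y = D" for x y :: complex
    using Cauchy_Schwarz_ineq2[of x y] that \<open>0 < D\<close> by (simp add: abs_mult)
  have "((V p - V 0) \<bullet> (V 1 - V 0)) / (D * D) = ((V 0 - V 1) \<bullet> (V 2 - V 1)) / (D * D)"
    using a0 a1 le nrm unfolding angle_at_def by (metis arccos_eq_iff)
  then have eq: "(V p - V 0) \<bullet> (V 1 - V 0) = (V 0 - V 1) \<bullet> (V 2 - V 1)"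
    using \<open>0 < D\<close> by simp
  have pt: "real p * \<theta> = 2 * pi - \<theta>"
  proof -
    have "real p = 2 * real m - 1" using p(1) by linarith
    then have "real p * \<theta> = 2 * (real m * \<theta>) - \<theta>" by (simp only: left_diff_distrib mult.assoc mult_1)
    then show ?thesis by (simp only: theta(3))
  qed
  have "(V p - V 0) \<bullet> (V 1 - V 0) = t\<^sup>2 * cos (2 * \<theta>) - 2 * t * cos \<theta> + 1"
  proof -
    have "cos (2 * pi - \<theta> - \<theta>) = cos (2 * \<theta>)"
      using cos_periodic[of "- 2 * \<theta>"] by (simp add: algebra_simps)
    moreover have "cos (2 * pi - \<theta>) = cos \<theta>" by (simp add: cos_diff)
    ultimately show ?thesis
      using p(2) pt inner_cis[of t "real p * \<theta>" t \<theta>] inner_cis[of t "real p * \<theta>" 1 0] inner_cis[of 1 0 t \<theta>]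
      unfolding alt_polygon_def alt_radius_def
      by (simp add: inner_diff_left inner_diff_right power2_eq_square)
  qed
  moreover have "(V 0 - V 1) \<bullet> (V 2 - V 1) = cos (2 * \<theta>) - 2 * t * cos \<theta> + t\<^sup>2"
    using inner_cis[of 1 0 1 "2 * \<theta>"] inner_cis[of t \<theta> 1 "2 * \<theta>"] inner_cis[of 1 0 t \<theta>] inner_cis[of t \<theta> t \<theta>]
    unfolding alt_polygon_def alt_radius_def
    by (simp add: inner_diff_left inner_diff_right power2_eq_square)
  ultimately have "(1 - t\<^sup>2) * (1 - cos (2 * \<theta>)) = 0"
    using eq by (simp add: algebra_simps)
  moreover have "t\<^sup>2 < 1" using t_pos t_less by (simp add: power_less_one_iff)
  moreover have "1 - cos (2 * \<theta>) = 2 * (sin \<theta>)\<^sup>2" using cos_double_sin[of \<theta>] by simp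
  ultimately show False using sin_theta by auto
qed

section \<open>Centroid, and recovery of the vertices from the curve\<close>

text \<open>Rotation by \<open>2 * pi / m\<close> permutes the vertices, so their sum is a fixed point of it.\<close>

lemma sum_V: "(\<Sum>j<2 * m. V j) = 0"
proof -
  let ?S = "\<Sum>j<2 * m. V j"
  have V_shift: "cis (2 * \<theta>) * V j = V (Suc (Suc j))" for j
  proof -
    have "real (Suc (Suc j)) * \<theta> = 2 * \<theta> + real j * \<theta>"
      by (simp add: algebra_simps add_divide_distrib)
    then show ?thesis
      by (simp add: alt_polygon_def alt_radius_def cis_mult[symmetric] mult_ac del: of_nat_Suc)
  qed
  have "V (2 * m) = V 0" "V (Suc (2 * m)) = V 1"
    using V_mod[of "2 * m"] V_mod[of "Suc (2 * m)"] m3 by (simp_all add: mod_Suc)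
  \<comment> \<open>Two extra terms are added at the end, equal to the first two by periodicity, so
    that the sum may be shifted by two indices.\<close>
  moreover have "(\<Sum>j<Suc (Suc (2 * m)). V j) = V 0 + (V 1 + (\<Sum>j<2 * m. V (Suc (Suc j))))"
    by (simp only: sum.lessThan_Suc_shift One_nat_def)
  ultimately have "?S = (\<Sum>j<2 * m. V (Suc (Suc j)))"
    by simp
  also have "\<dots> = cis (2 * \<theta>) * ?S"
    by (simp only: sum_distrib_left V_shift)
  finally have "(1 - cis (2 * \<theta>)) * ?S = 0"
    by (simp add: algebra_simps)
  moreover have "cis (2 * \<theta>) \<noteq> 1"
  proof
    assume "cis (2 * \<theta>) = 1"
    then have "cos (2 * \<theta>) = 1" by (simp add: complex_eq_iff)
    then show False using sin_theta cos_double_sin[of \<theta>] by simp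
  qed
  ultimately show ?thesis by auto
qed

lemma extreme_points: "{x. x extreme_point_of H} = V ` {..<2 * m}"
  using V_extreme extreme_point_of_convex_hull by blast

text \<open>Congruence speaks of curves only; this recovers the hull, and with it the vertices as
  extreme points.\<close>

lemma hull_curve: "convex hull (polygon_curve (2 * m) V) = H"
proof
  show "convex hull (polygon_curve (2 * m) V) \<subseteq> H"
    unfolding curve_eq using segment_subset_H by (intro hull_minimal convex_convex_hull) auto
  show "H \<subseteq> convex hull (polygon_curve (2 * m) V)"
    unfolding curve_eq by (intro hull_mono) auto
qed

lemma norm_V: "norm (V j) = r j"
  using r_pos[of j] by (simp add: alt_polygon_def norm_mult)

end

section \<open>Isometries and congruence\<close>

text \<open>The map is an injective linear map followed by a translation. Extreme points are the
  one-point faces, which both kinds of map preserve, and both commute with convex hulls.\<close>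

lemma isometry_image_extreme_points:
  fixes f :: "'a::euclidean_space \<Rightarrow> 'a"
  assumes "orthogonal_transformation (\<lambda>x. f x - c)"
  shows "f ` {x. x extreme_point_of (convex hull S)} = {x. x extreme_point_of (convex hull (f ` S))}"
proof -
  define g where "g = (\<lambda>x. f x - c)"
  have g: "linear g" "inj g"
    using assms by (auto simp: g_def intro: orthogonal_transformation_linear orthogonal_transformation_inj)
  have f: "f = (\<lambda>x. c + x) \<circ> g" by (auto simp: g_def)
  have "g ` {x. x extreme_point_of (convex hull S)} = {x. x extreme_point_of (g ` (convex hull S))}"
  proof -
    have "g x extreme_point_of (g ` (convex hull S)) \<longleftrightarrow> x extreme_point_of (convex hull S)" for x
      using face_of_linear_image[OF g, of "{x}" "convex hull S"] by (simp add: face_of_singleton)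
    moreover have "x extreme_point_of T \<Longrightarrow> x \<in> T" for x :: 'a and T
      by (simp add: extreme_point_of_def)
    ultimately show ?thesis by blast
  qed
  then show ?thesis
    unfolding f image_comp[symmetric] convex_hull_translation extreme_points_of_translation
    by (simp add: convex_hull_linear_image[OF g(1)])
qed

lemma alt_polygon_not_congruent:
  assumes "alternating_polygon m s" "alternating_polygon m t"
    and "congruent_polygons (2 * m) (alt_polygon m s) (alt_polygon m t)"
  shows "s = t"
proof -
  interpret S: alternating_polygon m s by fact
  interpret T: alternating_polygon m t by fact
  obtain f :: "complex \<Rightarrow> complex" where f: "\<And>x y. dist (f x) (f y) = dist x y"
    and im: "f ` polygon_curve (2 * m) (alt_polygon m s) = polygon_curve (2 * m) (alt_polygon m t)"
    using assms(3) unfolding congruent_polygons_def by blast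
  define g where "g = (\<lambda>x. f x - f 0)"
  \<comment> \<open>A distance-preserving map that fixes 0 is automatically linear.\<close>
  have g: "orthogonal_transformation g"
    unfolding orthogonal_transformation_isometry using f by (simp add: g_def dist_norm)
  have vert: "f ` alt_polygon m s ` {..<2 * m} = alt_polygon m t ` {..<2 * m}"
    using isometry_image_extreme_points[of f "f 0" "polygon_curve (2 * m) (alt_polygon m s)"] g
    unfolding im S.hull_curve T.hull_curve S.extreme_points T.extreme_points g_def by simp
  have "inj f" by (metis f injI dist_eq_0_iff)
  have "0 = (\<Sum>z\<in>alt_polygon m t ` {..<2 * m}. z)"
    using T.sum_V by (simp add: sum.reindex T.inj_V)
  also have "\<dots> = (\<Sum>j<2 * m. f (alt_polygon m s j))"
    unfolding vert[symmetric]
    by (simp add: sum.reindex S.inj_V inj_on_subset[OF \<open>inj f\<close>])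
  also have "\<dots> = (\<Sum>j<2 * m. f 0 + g (alt_polygon m s j))"
    by (simp add: g_def)
  also have "\<dots> = of_nat (2 * m) * f 0 + g (\<Sum>j<2 * m. alt_polygon m s j)"
    by (simp add: sum.distrib linear_sum[OF orthogonal_transformation_linear[OF g]])
  also have "\<dots> = of_nat (2 * m) * f 0"
    by (simp add: S.sum_V g_def)
  finally have "f 0 = 0" using S.m3 by simp
  \<comment> \<open>Vertex 1 has radius \<open>s\<close>. Its image has radius 1 or
    \<open>t\<close>, and \<open>s < 1\<close> excludes the former.\<close>
  have "1 \<in> {..<2 * m}" using S.m3 by auto
  then have "f (alt_polygon m s 1) \<in> alt_polygon m t ` {..<2 * m}"
    unfolding vert[symmetric] by (intro imageI)
  then obtain j where j: "f (alt_polygon m s 1) = alt_polygon m t j" by blast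
  have "norm (f (alt_polygon m s 1)) = norm (alt_polygon m s 1)"
    using f[of _ 0] \<open>f 0 = 0\<close> by simp
  then show "s = t"
    unfolding j S.norm_V T.norm_V using S.t_less by (auto simp: alt_radius_def split: if_splits)
qed

section \<open>Assembling the family\<close>

theorem theorem10:
  fixes n k :: nat
  assumes "even n" and "odd k" and "2 \<le> k" and "2 * k \<le> n"
  shows "\<exists>(a::real) (b::real) (F :: real \<Rightarrow> nat \<Rightarrow> complex).
           a < b \<and>
           (\<forall>i<n. continuous_on {a<..<b} (\<lambda>t. F t i)) \<and>
           (\<forall>t\<in>{a<..<b}. bicycle_polygon n k (F t) \<and> convex_polygon n (F t) \<and>
                          \<not> regular_polygon n (F t)) \<and>
           (\<forall>s\<in>{a<..<b}. \<forall>t\<in>{a<..<b}. s \<noteq> t \<longrightarrow> \<not> congruent_polygons n (F s) (F t))"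
proof -
  obtain m where n: "n = 2 * m" using \<open>even n\<close> by blast
  \<comment> \<open>An odd \<open>k\<close> with \<open>2 \<le> k\<close> is at least 3, and
    \<open>k \<le> m\<close>.\<close>
  have "k \<noteq> 2" using \<open>odd k\<close> by auto
  then have m: "3 \<le> m" using assms n by linarith
  have loc: "alternating_polygon m t" if "t \<in> {cos (pi / real m)<..<1}" for t
    using that m by unfold_locales auto
  have "cos (pi / real m) < 1"
    using cos_monotone_0_pi[of 0 "pi / real m"] m by (simp add: divide_le_eq)
  moreover have "continuous_on {cos (pi / real m)<..<1} (\<lambda>t. alt_polygon m t i)" for i
    by (cases "even i") (auto simp: alt_polygon_def alt_radius_def intro!: continuous_intros)
  moreover have "bicycle_polygon n k (alt_polygon m t)"
    if "t \<in> {cos (pi / real m)<..<1}" for t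
    using alternating_polygon.diagonal_odd[OF loc[OF that]] assms
    unfolding bicycle_polygon_def n by simp
  ultimately show ?thesis
    using alternating_polygon.convex[OF loc] alternating_polygon.not_regular[OF loc]
      alt_polygon_not_congruent[OF loc loc]
    unfolding n by (intro exI[of _ "cos (pi / real m)"] exI[of _ 1] exI[of _ "alt_polygon m"]) blast
qed

end
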